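(* Let $\mathbb M=\mathbb M(c)$ be a rank $2$ indecomposable module determined by coefficients $c=(c_1,\dots,c_8)\in\mathbb C[[t]]^8$ with $\sum_{i=1}^8c_i=0$, satisfying $t\nmid c_i+c_{i+1}$ and $t\nmid c_i+c_{i+1}+c_{i+2}+c_{i+3}$ for all odd $i$ (indices mod $8$). Then there exists $\beta\in\mathbb C\setminus\{0,1,-1\}$ such that $\mathbb M$ is isomorphic to $\mathbb M_\beta$.
   Context: Let $\Gamma_8$ be the quiver with vertices $1,\dots,8$ on a cycle (indices mod $8$, vertex $0$ is vertex $8$) and arrows $x_i:i-1\to i$, $y_i:i\to i-1$. $B_{4,8}$ is the quotient of the completed path algebra of $\Gamma_8$ over $\mathbb C$ by the closure of the ideal generated by $xy=yx$ and $x^4=y^4$ at every vertex. Its centre is $\mathbb C[[t]]$, $t=\sum_i x_iy_i$, and $\mathrm{CM}(B_{4,8})$ is the category of $B_{4,8}$-modules that are (finitely generated and) free over $\mathbb C[[t]]$; the rank of such a module is the common $\mathbb C[[t]]$-rank at the vertices. For $b=(b_1,\dots,b_8)\in\mathbb C[[t]]^8$ with $\sum_{i=1}^8b_i=0$, $\mathbb M(b)\in\mathrm{CM}(B_{4,8})$ is the rank $2$ module with $\mathbb C[[t]]\oplus\mathbb C[[t]]$ at each vertex and $$x_i=\begin{pmatrix}t&b_i\\0&1\end{pmatrix},\ y_i=\begin{pmatrix}1&-b_i\\0&t\end{pmatrix}\ (i\text{ odd}),\qquad x_i=\begin{pmatrix}1&b_i\\0&t\end{pmatrix},\ y_i=\begin{pmatrix}t&-b_i\\0&1\end{pmatrix}\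 (i\text{ even}).$$ Divisibility is in $\mathbb C[[t]]$. For $\beta\in\mathbb C\setminus\{0,1,-1\}$, $\mathbb M_\beta$ denotes the module $\mathbb M(b)$ for a choice of coefficients with $b_1+b_2=-(b_5+b_6)=1$ and $b_3+b_4=-(b_7+b_8)=\beta$ (its isomorphism class depends only on these sums). *)

theory Defs
  imports "HOL-Analysis.Analysis" "HOL-Algebra.QuotRing" "HOL-Algebra.Module"
begin

section \<open>Modules over a not necessarily commutative ring\<close>

locale left_module = R?: ring R + M?: abelian_group M for R and M (structure) +
  assumes smult_closed:
      "\<lbrakk>a \<in> carrier R; x \<in> carrier M\<rbrakk> \<Longrightarrow> a \<odot>\<^bsub>M\<^esub> x \<in> carrier M"
    and smult_l_distr:
      "\<lbrakk>a \<in> carrier R; b \<in> carrier R; x \<in> carrier M\<rbrakk> \<Longrightarrow>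
        (a \<oplus>\<^bsub>R\<^esub> b) \<odot>\<^bsub>M\<^esub> x = a \<odot>\<^bsub>M\<^esub> x \<oplus>\<^bsub>M\<^esub> b \<odot>\<^bsub>M\<^esub> x"
    and smult_r_distr:
      "\<lbrakk>a \<in> carrier R; x \<in> carrier M; y \<in> carrier M\<rbrakk> \<Longrightarrow>
        a \<odot>\<^bsub>M\<^esub> (x \<oplus>\<^bsub>M\<^esub> y) = a \<odot>\<^bsub>M\<^esub> x \<oplus>\<^bsub>M\<^esub> a \<odot>\<^bsub>M\<^esub> y"
    and smult_assoc:
      "\<lbrakk>a \<in> carrier R; b \<in> carrier R; x \<in> carrier M\<rbrakk> \<Longrightarrow>
        (a \<otimes>\<^bsub>R\<^esub> b) \<odot>\<^bsub>M\<^esub> x = a \<odot>\<^bsub>M\<^esub> (b \<odot>\<^bsub>M\<^esub> x)"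
    and smult_one: "x \<in> carrier M \<Longrightarrow> \<one>\<^bsub>R\<^esub> \<odot>\<^bsub>M\<^esub> x = x"

definition module_isomorphic ::
  "('r, 'q) ring_scheme \<Rightarrow> ('r, 'a, 'm) module_scheme \<Rightarrow> ('r, 'b, 'n) module_scheme \<Rightarrow> bool" where
  "module_isomorphic R M N \<longleftrightarrow>
     (\<exists>h. bij_betw h (carrier M) (carrier N) \<and>
          (\<forall>x\<in>carrier M. \<forall>y\<in>carrier M. h (x \<oplus>\<^bsub>M\<^esub> y) = h x \<oplus>\<^bsub>N\<^esub> h y) \<and>
          (\<forall>a\<in>carrier R. \<forall>x\<in>carrier M. h (a \<odot>\<^bsub>M\<^esub> x) = a \<odot>\<^bsub>N\<^esub> h x))"

text \<open>The modules over the algebra \<open>B\<close> below that are free of finite rank over the power series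
  ring in \<open>t\<close> form a full subcategory of all modules which is closed under direct summands, so
  isomorphism and indecomposability do not depend on which of the two categories is meant.\<close>

definition indecomposable_module ::
  "('r, 'q) ring_scheme \<Rightarrow> ('r, 'a, 'm) module_scheme \<Rightarrow> bool" where
  "indecomposable_module R M \<longleftrightarrow>
     carrier M \<noteq> {\<zero>\<^bsub>M\<^esub>} \<and>
     (\<forall>U V. submodule U R M \<and> submodule V R M \<and>
            U \<inter> V = {\<zero>\<^bsub>M\<^esub>} \<and> U <+>\<^bsub>M\<^esub> V = carrier M \<longrightarrow>
            U = {\<zero>\<^bsub>M\<^esub>} \<or> V = {\<zero>\<^bsub>M\<^esub>})"


section \<open>The completed path algebra of the cyclic quiver\<close>

text \<open>Vertices are the elements of \<open>\<int>/8\<close> (so vertex \<open>8\<close> is vertex \<open>0\<close>);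
  \<open>Xarr i : i - 1 \<rightarrow> i\<close> and \<open>Yarr i : i \<rightarrow> i - 1\<close>.\<close>

type_synonym vertex = 8

datatype arrow = Xarr vertex | Yarr vertex

fun src :: "arrow \<Rightarrow> vertex" where
  "src (Xarr i) = i - 1"
| "src (Yarr i) = i"

fun tgt :: "arrow \<Rightarrow> vertex" where
  "tgt (Xarr i) = i"
| "tgt (Yarr i) = i - 1"

text \<open>A path is given by its starting vertex and the list of its arrows in the order in which
  they are traversed.\<close>

type_synonym path = "vertex \<times> arrow list"

fun is_walk :: "vertex \<Rightarrow> arrow list \<Rightarrow> bool" where
  "is_walk i [] \<longleftrightarrow> True"
| "is_walk i (a # as) \<longleftrightarrow> src a = i \<and> is_walk (tgt a) as"

fun end_vertex :: "vertex \<Rightarrow> arrow list \<Rightarrow> vertex" where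
  "end_vertex i [] = i"
| "end_vertex i (a # as) = end_vertex (tgt a) as"

text \<open>Elements of the completed path algebra are arbitrary, possibly infinite, formal linear
  combinations of paths. Paths compose from right to left, like the linear maps by which they act
  on a left module: in \<open>f \<otimes> g\<close> the path coming from \<open>g\<close> is traversed first.\<close>

definition path_algebra :: "(path \<Rightarrow> complex) ring" where
  "path_algebra =
    \<lparr>carrier = {f. \<forall>i as. \<not> is_walk i as \<longrightarrow> f (i, as) = 0},
     mult = (\<lambda>f g (i, as). \<Sum>k\<le>length as.
               f (end_vertex i (take k as), drop k as) * g (i, take k as)),
     one = (\<lambda>(i, as). if as = [] then 1 else 0),
     zero = (\<lambda>p. 0),
     add = (\<lambda>f g p. f p + g p)\<rparr>"

definition arr :: "arrow \<Rightarrow> path \<Rightarrow> complex" where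
  "arr a = (\<lambda>p. if p = (src a, [a]) then 1 else 0)"

abbreviation x_el :: "vertex \<Rightarrow> path \<Rightarrow> complex" where "x_el i \<equiv> arr (Xarr i)"
abbreviation y_el :: "vertex \<Rightarrow> path \<Rightarrow> complex" where "y_el i \<equiv> arr (Yarr i)"

definition relations :: "(path \<Rightarrow> complex) set" where
  "relations =
     {x_el i \<otimes>\<^bsub>path_algebra\<^esub> y_el i \<ominus>\<^bsub>path_algebra\<^esub> y_el (i+1) \<otimes>\<^bsub>path_algebra\<^esub> x_el (i+1) | i. True} \<union>
     {x_el (i+4) \<otimes>\<^bsub>path_algebra\<^esub> x_el (i+3) \<otimes>\<^bsub>path_algebra\<^esub> x_el (i+2) \<otimes>\<^bsub>path_algebra\<^esub> x_el (i+1)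
        \<ominus>\<^bsub>path_algebra\<^esub>
      y_el (i-3) \<otimes>\<^bsub>path_algebra\<^esub> y_el (i-2) \<otimes>\<^bsub>path_algebra\<^esub> y_el (i-1) \<otimes>\<^bsub>path_algebra\<^esub> y_el i | i. True}"

text \<open>Closure with respect to the arrow-adic topology, in which two elements are close if they
  have the same coefficients at all short paths.\<close>

definition adic_closure :: "(path \<Rightarrow> complex) set \<Rightarrow> (path \<Rightarrow> complex) set" where
  "adic_closure I =
     {f \<in> carrier path_algebra. \<forall>n. \<exists>g\<in>I. \<forall>i as. length as < n \<longrightarrow> f (i, as) = g (i, as)}"

definition B48 :: "(path \<Rightarrow> complex) set ring" where
  "B48 = path_algebra Quot adic_closure (Idl\<^bsub>path_algebra\<^esub> relations)"


section \<open>The modules $\mathbb{M}(b)$ and $\mathbb{M}_\beta$\<close>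

definition mat22 :: "'a \<Rightarrow> 'a \<Rightarrow> 'a \<Rightarrow> 'a \<Rightarrow> 'a::zero ^ 2 ^ 2" where
  "mat22 p q r s = vector [vector [p, q], vector [r, s]]"

fun arrow_matrix :: "(vertex \<Rightarrow> complex fps) \<Rightarrow> arrow \<Rightarrow> complex fps ^ 2 ^ 2" where
  "arrow_matrix b (Xarr i) = (if 2 dvd i then mat22 1 (b i) 0 fps_X else mat22 fps_X (b i) 0 1)"
| "arrow_matrix b (Yarr i) = (if 2 dvd i then mat22 fps_X (- b i) 0 1 else mat22 1 (- b i) 0 fps_X)"

fun path_matrix :: "(vertex \<Rightarrow> complex fps) \<Rightarrow> arrow list \<Rightarrow> complex fps ^ 2 ^ 2" where
  "path_matrix b [] = mat 1"
| "path_matrix b (a # as) = path_matrix b as ** arrow_matrix b a"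

text \<open>Elements of $\mathbb{M}(b)$ are families of vectors indexed by the vertices. An infinite
  combination of paths acts by the \<open>t\<close>-adic limit of its truncations (the topology on
  \<^typ>\<open>complex fps\<close> is the \<open>t\<close>-adic one).\<close>

definition truncated_action ::
  "(vertex \<Rightarrow> complex fps) \<Rightarrow> (path \<Rightarrow> complex) \<Rightarrow> (vertex \<Rightarrow> complex fps ^ 2) \<Rightarrow> vertex \<Rightarrow> nat \<Rightarrow>
    complex fps ^ 2" where
  "truncated_action b f m j n =
     (\<Sum>(i, as) | is_walk i as \<and> end_vertex i as = j \<and> length as < n.
        fps_const (f (i, as)) *s (path_matrix b as *v m i))"

definition path_action ::
  "(vertex \<Rightarrow> complex fps) \<Rightarrow> (path \<Rightarrow> complex) \<Rightarrow> (vertex \<Rightarrow> complex fps ^ 2) \<Rightarrow>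
    vertex \<Rightarrow> complex fps ^ 2" where
  "path_action b f m = (\<lambda>j. lim (truncated_action b f m j))"

text \<open>The ring fields \<open>mult\<close> and \<open>one\<close> of a module record play no role. When
  \<open>\<Sum>i. b i = 0\<close>, the action of a residue class does not depend on the representative and
  $\mathbb{M}(b)$ is a module over \<^const>\<open>B48\<close>; see \<open>MM_smult_coset\<close> and \<open>left_module_MM\<close> below.\<close>

definition MM :: "(vertex \<Rightarrow> complex fps) \<Rightarrow>
    ((path \<Rightarrow> complex) set, vertex \<Rightarrow> complex fps ^ 2) module" where
  "MM b =
    \<lparr>carrier = UNIV,
     mult = undefined,
     one = undefined,
     zero = (\<lambda>j. 0),
     add = (\<lambda>m m' j. m j + m' j),
     smult = (\<lambda>C m. path_action b (SOME f. f \<in> C) m)\<rparr>"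

definition M_beta_coeffs :: "complex \<Rightarrow> (vertex \<Rightarrow> complex fps) \<Rightarrow> bool" where
  "M_beta_coeffs \<beta> b \<longleftrightarrow>
     b 1 + b 2 = 1 \<and> b 5 + b 6 = - 1 \<and>
     b 3 + b 4 = fps_const \<beta> \<and> b 7 + b 8 = - fps_const \<beta>"

text \<open>Coefficients as required exist, and they have sum zero: \<open>M_beta_coeffs_exist\<close> and
  \<open>M_beta_coeffs_sum\<close> below.\<close>

definition M_beta :: "complex \<Rightarrow> ((path \<Rightarrow> complex) set, vertex \<Rightarrow> complex fps ^ 2) module" where
  "M_beta \<beta> = MM (SOME b. M_beta_coeffs \<beta> b)"

section \<open>The completed path algebra and its quotient are rings\<close>

lemma pa_simps:
  "f \<in> carrier path_algebra \<longleftrightarrow> (\<forall>i as. \<not> is_walk i as \<longrightarrow> f (i, as) = 0)"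
  "(f \<otimes>\<^bsub>path_algebra\<^esub> g) (i, as) =
     (\<Sum>k\<le>length as. f (end_vertex i (take k as), drop k as) * g (i, take k as))"
  "\<one>\<^bsub>path_algebra\<^esub> (i, as) = (if as = [] then 1 else 0)"
  "\<zero>\<^bsub>path_algebra\<^esub> = (\<lambda>p. 0)"
  "f \<oplus>\<^bsub>path_algebra\<^esub> g = (\<lambda>p. f p + g p)"
  by (auto simp: path_algebra_def)

lemma is_walk_append: "is_walk i (as @ bs) \<longleftrightarrow> is_walk i as \<and> is_walk (end_vertex i as) bs"
  by (induction as arbitrary: i) auto

lemma end_vertex_append: "end_vertex i (as @ bs) = end_vertex (end_vertex i as) bs"
  by (induction as arbitrary: i) auto

lemma is_walk_take_drop:
  "is_walk i as \<longleftrightarrow> is_walk i (take k as) \<and> is_walk (end_vertex i (take k as)) (drop k as)"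
  by (metis append_take_drop_id is_walk_append)

lemma end_vertex_take_drop:
  "end_vertex (end_vertex i (take k as)) (drop k as) = end_vertex i as"
  by (metis append_take_drop_id end_vertex_append)

lemma path_algebra_assoc:
  "(f \<otimes>\<^bsub>path_algebra\<^esub> g) \<otimes>\<^bsub>path_algebra\<^esub> h = f \<otimes>\<^bsub>path_algebra\<^esub> (g \<otimes>\<^bsub>path_algebra\<^esub> h)"
proof -
  have "((f \<otimes>\<^bsub>path_algebra\<^esub> g) \<otimes>\<^bsub>path_algebra\<^esub> h) (i, as) =
    (f \<otimes>\<^bsub>path_algebra\<^esub> (g \<otimes>\<^bsub>path_algebra\<^esub> h)) (i, as)" for i as
  proof -
  let ?n = "length as"
  let ?F = "\<lambda>k l. f (end_vertex i (take l as), drop l as) *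
               g (end_vertex i (take k as), drop k (take l as)) * h (i, take k as)"
  have E: "end_vertex (end_vertex i (take k as)) (take l (drop k as)) = end_vertex i (take (k + l) as)"
    for k l
    by (metis end_vertex_append take_add)
  have "((f \<otimes>\<^bsub>path_algebra\<^esub> g) \<otimes>\<^bsub>path_algebra\<^esub> h) (i, as) =
     (\<Sum>k\<le>?n. \<Sum>l\<le>?n - k. ?F k (k + l))"
    unfolding pa_simps sum_distrib_right
    by (intro sum.cong refl) (simp_all add: E drop_take add.commute)
  also have "\<dots> = (\<Sum>(k, l)\<in>Sigma {..?n} (\<lambda>k. {..?n - k}). ?F k (k + l))"
    by (rule sum.Sigma) auto
  also have "\<dots> = (\<Sum>(l, k)\<in>Sigma {..?n} (\<lambda>l. {..l}). ?F k l)"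
    by (rule sum.reindex_bij_witness[where i = "\<lambda>(l, k). (k, l - k)" and j = "\<lambda>(k, l). (k + l, k)"])
      auto
  also have "\<dots> = (\<Sum>l\<le>?n. \<Sum>k\<le>l. ?F k l)"
    by (rule sum.Sigma[symmetric]) auto
  also have "\<dots> = (f \<otimes>\<^bsub>path_algebra\<^esub> (g \<otimes>\<^bsub>path_algebra\<^esub> h)) (i, as)"
    unfolding pa_simps sum_distrib_left
    by (intro sum.cong refl) (auto simp: min_def mult.assoc split: if_splits intro!: sum.cong)
  finally show ?thesis .
  qed
  then show ?thesis by (simp add: fun_eq_iff)
qed

lemma path_algebra_one:
  "\<one>\<^bsub>path_algebra\<^esub> \<otimes>\<^bsub>path_algebra\<^esub> f = f" "f \<otimes>\<^bsub>path_algebra\<^esub> \<one>\<^bsub>path_algebra\<^esub> = f"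
proof -
  have "(\<one>\<^bsub>path_algebra\<^esub> \<otimes>\<^bsub>path_algebra\<^esub> f) (i, as) = f (i, as)" for i as
  proof -
    have "(\<one>\<^bsub>path_algebra\<^esub> \<otimes>\<^bsub>path_algebra\<^esub> f) (i, as) =
      (\<Sum>k\<le>length as. if k = length as then f (i, take k as) else 0)"
      unfolding pa_simps by (intro sum.cong) auto
    then show ?thesis by simp
  qed
  moreover have "(f \<otimes>\<^bsub>path_algebra\<^esub> \<one>\<^bsub>path_algebra\<^esub>) (i, as) = f (i, as)" for i as
  proof -
    have "(f \<otimes>\<^bsub>path_algebra\<^esub> \<one>\<^bsub>path_algebra\<^esub>) (i, as) =
      (\<Sum>k\<le>length as. if k = 0 then f (end_vertex i (take k as), drop k as) else 0)"
      unfolding pa_simps by (intro sum.cong) (auto simp: )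
    then show ?thesis by simp
  qed
  ultimately show
    "\<one>\<^bsub>path_algebra\<^esub> \<otimes>\<^bsub>path_algebra\<^esub> f = f" "f \<otimes>\<^bsub>path_algebra\<^esub> \<one>\<^bsub>path_algebra\<^esub> = f"
    by auto
qed

lemma ring_path_algebra: "ring path_algebra"
proof (rule ringI)
  show "abelian_group path_algebra"
  proof (rule abelian_groupI)
    fix f assume f: "f \<in> carrier path_algebra"
    show "\<exists>g\<in>carrier path_algebra. g \<oplus>\<^bsub>path_algebra\<^esub> f = \<zero>\<^bsub>path_algebra\<^esub>"
      using f by (intro bexI[of _ "\<lambda>p. - f p"]) (auto simp: pa_simps)
  qed (auto simp: pa_simps add_ac)
  show "monoid path_algebra"
  proof (rule monoidI)
    fix f g assume "f \<in> carrier path_algebra" "g \<in> carrier path_algebra"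
    then show "f \<otimes>\<^bsub>path_algebra\<^esub> g \<in> carrier path_algebra"
      unfolding pa_simps by (metis (no_types, lifting) is_walk_take_drop mult_eq_0_iff sum.neutral)
  qed (auto simp: path_algebra_assoc path_algebra_one, auto simp: pa_simps)
qed (auto simp: pa_simps fun_eq_iff distrib_left distrib_right sum.distrib)

lemma relations_subset: "relations \<subseteq> carrier path_algebra"
proof -
  interpret ring path_algebra by (rule ring_path_algebra)
  have [simp]: "arr a \<in> carrier path_algebra" for a
    by (auto simp: pa_simps arr_def)
  show ?thesis
    unfolding relations_def by (auto intro!: minus_closed m_closed)
qed

lemma ideal_adic_closure:
  assumes "ideal I path_algebra"
  shows "ideal (adic_closure I) path_algebra"
proof -
  interpret ring path_algebra by (rule ring_path_algebra)
  interpret I: ideal I path_algebra by (rule assms)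
  have neg: "\<ominus>\<^bsub>path_algebra\<^esub> f = (\<lambda>p. - f p)" if "f \<in> carrier path_algebra" for f
    by (rule minus_equality) (use that in \<open>auto simp: pa_simps\<close>)
  have inI: "f \<in> adic_closure I \<longleftrightarrow> f \<in> carrier path_algebra \<and>
      (\<forall>n. \<exists>g\<in>I. \<forall>i as. length as < n \<longrightarrow> f (i, as) = g (i, as))" for f
    by (simp add: adic_closure_def)
  show ?thesis
  proof (rule idealI)
    show "subgroup (adic_closure I) (add_monoid path_algebra)"
    proof (rule subgroup.intro)
      show "adic_closure I \<subseteq> carrier (add_monoid path_algebra)"
        by (auto simp: adic_closure_def)
    next
      fix f g assume fg: "f \<in> adic_closure I" "g \<in> adic_closure I"
      have "\<exists>h\<in>I. \<forall>i as. length as < n \<longrightarrow> (f \<oplus>\<^bsub>path_algebra\<^esub> g) (i, as) = h (i, as)" for n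
      proof -
        obtain f' g' where "f' \<in> I" "g' \<in> I"
          "\<forall>i as. length as < n \<longrightarrow> f (i, as) = f' (i, as)"
          "\<forall>i as. length as < n \<longrightarrow> g (i, as) = g' (i, as)"
          using fg unfolding inI by meson
        then show ?thesis
          by (intro bexI[of _ "f' \<oplus>\<^bsub>path_algebra\<^esub> g'"]) (use I.a_closed[of f' g'] in \<open>auto simp: pa_simps(5)\<close>)
      qed
      then show "f \<otimes>\<^bsub>add_monoid path_algebra\<^esub> g \<in> adic_closure I"
        using fg by (auto simp: inI)
    next
      show "\<one>\<^bsub>add_monoid path_algebra\<^esub> \<in> adic_closure I"
        using I.zero_closed zero_closed by (auto simp: inI)
    next
      fix f assume f: "f \<in> adic_closure I"
      have "\<exists>h\<in>I. \<forall>i as. length as < n \<longrightarrow> (\<ominus>\<^bsub>path_algebra\<^esub> f) (i, as) = h (i, as)" for n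
      proof -
        obtain f' where f': "f' \<in> I" "\<forall>i as. length as < n \<longrightarrow> f (i, as) = f' (i, as)"
          using f unfolding inI by meson
        have "f \<in> carrier path_algebra" "f' \<in> carrier path_algebra"
          using f f'(1) I.Icarr unfolding inI by auto
        then show ?thesis
          using f' by (intro bexI[of _ "\<ominus>\<^bsub>path_algebra\<^esub> f'"]) (use I.a_inv_closed[of f'] in \<open>auto simp: neg\<close>)
      qed
      then show "inv\<^bsub>add_monoid path_algebra\<^esub> f \<in> adic_closure I"
        using f a_inv_closed[of f] unfolding inI a_inv_def by blast
    qed
  next
    fix f g assume f: "f \<in> adic_closure I" and g: "g \<in> carrier path_algebra"
    have "\<exists>h\<in>I. \<forall>i as. length as < n \<longrightarrow> (g \<otimes>\<^bsub>path_algebra\<^esub> f) (i, as) = h (i, as)" for n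
    proof -
      obtain f' where f': "f' \<in> I" "\<forall>i as. length as < n \<longrightarrow> f (i, as) = f' (i, as)"
        using f unfolding inI by meson
      then show ?thesis
        by (intro bexI[of _ "g \<otimes>\<^bsub>path_algebra\<^esub> f'"])
          (auto simp: pa_simps(2) I.I_l_closed g intro!: sum.cong)
    qed
    then show "g \<otimes>\<^bsub>path_algebra\<^esub> f \<in> adic_closure I"
      using f g by (auto simp: inI)
    have "\<exists>h\<in>I. \<forall>i as. length as < n \<longrightarrow> (f \<otimes>\<^bsub>path_algebra\<^esub> g) (i, as) = h (i, as)" for n
    proof -
      obtain f' where f': "f' \<in> I" "\<forall>i as. length as < n \<longrightarrow> f (i, as) = f' (i, as)"
        using f unfolding inI by meson
      then show ?thesis
        by (intro bexI[of _ "f' \<otimes>\<^bsub>path_algebra\<^esub> g"])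
          (auto simp: pa_simps(2) I.I_r_closed g intro!: sum.cong)
    qed
    then show "f \<otimes>\<^bsub>path_algebra\<^esub> g \<in> adic_closure I"
      using f g by (auto simp: inI)
  qed (rule ring_path_algebra)
qed

lemma ring_B48: "ring B48"
  unfolding B48_def
  by (intro ideal.quotient_is_ring ideal_adic_closure ring.genideal_ideal
      ring_path_algebra relations_subset)

section \<open>$\mathbb{M}(b)$ is a module\<close>

lemma vertex_cases: "i = 0 \<or> i = 1 \<or> i = 2 \<or> i = 3 \<or> i = 4 \<or> i = 5 \<or> i = 6 \<or> i = (7::vertex)"
proof (cases i)
  case (of_int z)
  then have "z = 0 \<or> z = 1 \<or> z = 2 \<or> z = 3 \<or> z = 4 \<or> z = 5 \<or> z = 6 \<or> z = 7"
    by auto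
  then show ?thesis using of_int by auto
qed
lemma odd_vertex:  "\<not> 2 dvd (1::vertex)" "\<not> 2 dvd (3::vertex)" "\<not> 2 dvd (5::vertex)" "\<not> 2 dvd (7::vertex)"
proof -
  have "2 * j \<notin> {1,3,5,7}" for j :: vertex
    using vertex_cases[of j] by (elim disjE) (simp_all)
  then show "\<not> 2 dvd (1::vertex)" "\<not> 2 dvd (3::vertex)" "\<not> 2 dvd (5::vertex)" "\<not> 2 dvd (7::vertex)"
    by (metis dvdE insertCI)+
qed
lemma even_vertex: "2 dvd (0::vertex)" "2 dvd (2::vertex)" "2 dvd (4::vertex)" "2 dvd (6::vertex)"
 using dvd_triv_left[of 2 "2::vertex"] dvd_triv_left[of 2 "3::vertex"] by simp_all

lemma two_dvd_vertex: "2 dvd i + 1 \<longleftrightarrow> \<not> 2 dvd i" "2 dvd i - 1 \<longleftrightarrow> \<not> 2 dvd i" for i :: vertex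
proof -
  have *: "2 dvd i + 1 \<longleftrightarrow> \<not> 2 dvd i" for i :: vertex
  proof -
    obtain z where z: "i = of_int z" by (cases i)
    have dvd: "2 dvd (of_int w :: vertex)" if "2 dvd w" for w
      using that by (metis dvd_def of_int_mult of_int_numeral)
    have "2 dvd i \<or> 2 dvd i + 1"
    proof (cases "2 dvd z")
      case True
      then show ?thesis using dvd z by blast
    next
      case False
      then have "2 dvd z + 1" by presburger
      then show ?thesis using dvd[of "z + 1"] z by simp
    qed
    moreover have "\<not> (2 dvd i \<and> 2 dvd i + 1)"
      using odd_vertex(1) dvd_diff[of 2 "i + 1" i] by auto
    ultimately show ?thesis by blast
  qed
  show "2 dvd i + 1 \<longleftrightarrow> \<not> 2 dvd i" by (rule *)
  show "2 dvd i - 1 \<longleftrightarrow> \<not> 2 dvd i" using *[of "i - 1"] by (metis diff_add_cancel)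
qed

lemma finite_arrows: "finite (UNIV :: arrow set)"
proof -
  have "(UNIV :: arrow set) \<subseteq> range Xarr \<union> range Yarr"
    by (metis (full_types) UNIV_I Un_iff arrow.exhaust rangeI subsetI)
  then show ?thesis by (rule finite_subset) simp
qed

lemma mat22_mult:
  fixes p :: "'a :: semiring_1"
  shows "mat22 p q r s ** mat22 p' q' r' s' =
    mat22 (p * p' + q * r') (p * q' + q * s') (r * p' + s * r') (r * q' + s * s')"
  by (simp add: mat22_def matrix_matrix_mult_def vec_eq_iff forall_2 sum_2)

definition tdvd :: "nat \<Rightarrow> complex fps ^ 2 ^ 2 \<Rightarrow> bool" where
  "tdvd n A \<longleftrightarrow> (\<forall>i j. fps_X ^ n dvd A $ i $ j)"

lemma tdvd_mult: "tdvd m A \<Longrightarrow> tdvd n B \<Longrightarrow> tdvd (m + n) (A ** B)"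
  unfolding tdvd_def matrix_matrix_mult_def
  by (auto simp: power_add intro!: dvd_sum mult_dvd_mono)

lemma fps_X_power_dvd: "fps_X ^ n dvd (f :: complex fps) \<longleftrightarrow> (\<forall>k<n. fps_nth f k = 0)"
proof
  assume "\<forall>k<n. fps_nth f k = 0"
  then have "f = fps_X ^ n * fps_shift n f"
    by (auto simp: fps_eq_iff fps_X_power_mult_nth)
  then show "fps_X ^ n dvd f" by (metis dvd_triv_left)
qed (auto simp: fps_X_power_mult_nth)

lemma tdvd_mat22: "tdvd n (mat22 p q r s) \<longleftrightarrow>
  fps_X ^ n dvd p \<and> fps_X ^ n dvd q \<and> fps_X ^ n dvd r \<and> fps_X ^ n dvd s"
  by (auto simp: tdvd_def mat22_def forall_2)

lemma path_matrix_append: "path_matrix b (as @ bs) = path_matrix b bs ** path_matrix b as"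
  by (induction as) (simp_all add: matrix_mul_assoc)

lemma tdvd_one_mat22: "tdvd 1 (mat22 p q r s) \<longleftrightarrow>
  fps_nth p 0 = 0 \<and> fps_nth q 0 = 0 \<and> fps_nth r 0 = 0 \<and> fps_nth s 0 = 0"
  unfolding tdvd_mat22 fps_X_power_dvd by simp

lemma tdvd_three:
  assumes "is_walk i [a1, a2, a3]"
  shows "tdvd 1 (path_matrix b [a1, a2, a3])"
proof -
  have *: "path_matrix b [a1, a2, a3] = arrow_matrix b a3 ** (arrow_matrix b a2 ** arrow_matrix b a1)"
    by (simp add: matrix_mul_assoc)
  have XX: "(2 dvd i) = (\<not> 2 dvd j)" if "j - 1 = i" for i j :: vertex
    using two_dvd_vertex(2)[of j] that by simp
  show ?thesis
    unfolding * using assms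
    apply (cases a1; cases a2; cases a3; clarsimp simp only: is_walk.simps src.simps tgt.simps arrow_matrix.simps)
    apply (simp_all only: two_dvd_vertex mat22_mult tdvd_one_mat22 split: if_split)
    apply (auto simp: two_dvd_vertex two_dvd_vertex(1)[unfolded add.commute[of _ 1]])
    done
qed

lemma tdvd_long:
  "is_walk i as \<Longrightarrow> 3 * n \<le> length as \<Longrightarrow> tdvd n (path_matrix b as)"
proof (induction n arbitrary: i as)
  case 0
  then show ?case by (simp add: tdvd_def)
next
  case (Suc n)
  then obtain a1 a2 a3 bs where as: "as = [a1, a2, a3] @ bs"
    by (cases as; cases "tl as"; cases "tl (tl as)") auto
  have "tdvd n (path_matrix b bs)"
    using Suc.prems by (intro Suc.IH[of "tgt a3"]) (auto simp: as)
  moreover have "tdvd 1 (path_matrix b [a1, a2, a3])"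
    using Suc.prems by (intro tdvd_three[of i]) (auto simp: as)
  ultimately show ?case
    unfolding as path_matrix_append using tdvd_mult by fastforce
qed

definition vdvd :: "nat \<Rightarrow> complex fps ^ 2 \<Rightarrow> bool" where
  "vdvd n v \<longleftrightarrow> (\<forall>i. fps_X ^ n dvd v $ i)"

lemma vdvd_simps:
  "vdvd n 0" "vdvd n v \<Longrightarrow> vdvd n w \<Longrightarrow> vdvd n (v + w)" "vdvd n v \<Longrightarrow> vdvd n w \<Longrightarrow> vdvd n (v - w)"
  "vdvd n v \<Longrightarrow> vdvd n (c *s v)" "vdvd n v \<Longrightarrow> vdvd n (A *v v)"
  by (auto simp: vdvd_def tdvd_def matrix_vector_mult_def intro!: dvd_sum dvd_mult dvd_add dvd_diff)

lemma vdvd_tdvd: "tdvd n A \<Longrightarrow> vdvd n (A *v v)"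
  unfolding vdvd_def tdvd_def matrix_vector_mult_def vec_lambda_beta
  by (intro allI dvd_sum dvd_mult2) blast

lemma vdvd_sum: "(\<And>z. z \<in> S \<Longrightarrow> vdvd n (F z)) \<Longrightarrow> vdvd n (sum F S)"
  by (induction S rule: infinite_finite_induct) (auto intro: vdvd_simps)

lemma vdvd_eqI: "(\<And>n. vdvd n (v - w)) \<Longrightarrow> v = w"
  unfolding vdvd_def fps_X_power_dvd vec_eq_iff fps_eq_iff
  by (metis eq_iff_diff_eq_0 fps_sub_nth lessI vector_minus_component)

definition Wset :: "vertex \<Rightarrow> nat \<Rightarrow> path set" where
  "Wset j n = {(i, as). is_walk i as \<and> end_vertex i as = j \<and> length as < n}"

lemma finite_Wset: "finite (Wset j n)"
proof -
  have "Wset j n \<subseteq> UNIV \<times> {as. set as \<subseteq> UNIV \<and> length as \<le> n}"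
    by (auto simp: Wset_def)
  then show ?thesis
    by (rule finite_subset) (intro finite_cartesian_product finite_lists_length_le finite_arrows finite)
qed

lemma truncated_action_Wset: "truncated_action b f m j n =
   (\<Sum>p\<in>Wset j n. fps_const (f p) *s (path_matrix b (snd p) *v m (fst p)))"
  unfolding truncated_action_def Wset_def by (simp add: case_prod_beta)

lemma truncated_action_diff:
  assumes "3 * n \<le> l" "l \<le> l'"
  shows "vdvd n (truncated_action b f m j l' - truncated_action b f m j l)"
proof -
  have sub: "Wset j l \<subseteq> Wset j l'" using assms by (auto simp: Wset_def)
  show ?thesis
    unfolding truncated_action_Wset sum_diff[OF finite_Wset sub, symmetric]
    using assms
    by (intro vdvd_sum vdvd_simps(4) vdvd_tdvd)
      (auto simp: Wset_def not_less intro!: tdvd_long)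
qed

lemma path_action_diff:
  assumes "3 * n \<le> l"
  shows "vdvd n (path_action b f m j - truncated_action b f m j l)"
proof -
  let ?T = "truncated_action b f m j"
  define v :: "complex fps ^ 2" where
    "v = (\<chi> k. Abs_fps (\<lambda>n. fps_nth (?T (3 * (n + 1)) $ k) n))"
  have v: "fps_nth (?T l $ k) n = fps_nth (v $ k) n" if "3 * (n + 1) \<le> l" for l k n
    using truncated_action_diff[of "n + 1" "3 * (n + 1)" l b f m j] that
    unfolding vdvd_def fps_X_power_dvd v_def by auto
  have "?T \<longlonglongrightarrow> v"
    by (intro vec_tendstoI tendsto_fpsI eventually_sequentiallyI) (rule v)
  then have "path_action b f m j = v"
    unfolding path_action_def by (rule limI)
  then show ?thesis
    using assms v unfolding vdvd_def fps_X_power_dvd by auto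
qed

lemma path_action_eqI:
  assumes "\<And>n. \<exists>l\<ge>3 * n. vdvd n (w - truncated_action b f m j l)"
  shows "path_action b f m j = w"
proof (rule vdvd_eqI)
  fix n
  obtain l where l: "l \<ge> 3 * n" "vdvd n (w - truncated_action b f m j l)"
    using assms by blast
  from vdvd_simps(3)[OF path_action_diff[OF l(1), of b f m j] l(2)]
  show "vdvd n (path_action b f m j - w)" by simp
qed

lemma path_action_add_left:
  "path_action b (\<lambda>p. f p + g p) m j = path_action b f m j + path_action b g m j"
proof (rule path_action_eqI)
  fix n
  have "truncated_action b (\<lambda>p. f p + g p) m j (3 * n) =
    truncated_action b f m j (3 * n) + truncated_action b g m j (3 * n)"
    unfolding truncated_action_Wset fps_const_add[symmetric] vector_sadd_rdistrib sum.distrib ..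
  then show "\<exists>l\<ge>3 * n. vdvd n (path_action b f m j + path_action b g m j -
      truncated_action b (\<lambda>p. f p + g p) m j l)"
    using vdvd_simps(2)[OF path_action_diff path_action_diff, of n "3 * n" "3 * n" b f m j b g m j]
    by (intro exI[of _ "3 * n"]) (simp add: algebra_simps)
qed

lemma path_action_add_right:
  "path_action b f (\<lambda>i. m i + m' i) j = path_action b f m j + path_action b f m' j"
proof (rule path_action_eqI)
  fix n
  have "truncated_action b f (\<lambda>i. m i + m' i) j (3 * n) =
    truncated_action b f m j (3 * n) + truncated_action b f m' j (3 * n)"
    unfolding truncated_action_Wset
    by (simp flip: sum.distrib add: matrix_vector_right_distrib vector_add_ldistrib)
  then show "\<exists>l\<ge>3 * n. vdvd n (path_action b f m j + path_action b f m' j -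
      truncated_action b f (\<lambda>i. m i + m' i) j l)"
    using vdvd_simps(2)[OF path_action_diff path_action_diff, of n "3 * n" "3 * n" b f m j b f m' j]
    by (intro exI[of _ "3 * n"]) (simp add: algebra_simps)
qed

lemma path_action_finite:
  assumes "\<And>i as. length as \<ge> l \<Longrightarrow> f (i, as) = 0"
  shows "path_action b f m j = truncated_action b f m j l"
proof (rule path_action_eqI)
  fix n
  have sub: "Wset j l \<subseteq> Wset j (l + 3 * n)" by (auto simp: Wset_def)
  have "truncated_action b f m j (l + 3 * n) = truncated_action b f m j l"
    unfolding truncated_action_Wset
  proof (rule sum.mono_neutral_right[OF finite_Wset sub], rule ballI)
    fix p assume "p \<in> Wset j (l + 3 * n) - Wset j l"
    then have "f p = 0"
      using assms[of "snd p" "fst p"] by (cases "l \<le> length (snd p)") (auto simp: Wset_def)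
    then show "fps_const (f p) *s (path_matrix b (snd p) *v m (fst p)) = 0"
      by simp
  qed
  then show "\<exists>l'\<ge>3 * n. vdvd n (truncated_action b f m j l - truncated_action b f m j l')"
    by (intro exI[of _ "l + 3 * n"]) (simp add: vdvd_simps)
qed

lemma path_action_single:
  "path_action b (\<lambda>q. if q = (i, as) then c else 0) m j =
    (if is_walk i as \<and> end_vertex i as = j then fps_const c *s (path_matrix b as *v m i) else 0)"
proof -
  have "path_action b (\<lambda>q. if q = (i, as) then c else 0) m j =
     (\<Sum>p\<in>Wset j (Suc (length as)). if p = (i, as) then fps_const c *s (path_matrix b as *v m i) else 0)"
    by (subst path_action_finite[of "Suc (length as)"])
      (auto simp: truncated_action_Wset intro!: sum.cong)
  moreover have "(i, as) \<in> Wset j (Suc (length as)) \<longleftrightarrow> is_walk i as \<and> end_vertex i as = j"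
    by (auto simp: Wset_def)
  ultimately show ?thesis by (simp only: sum.delta' sum.delta finite_Wset)
qed

lemma matrix_vector_mult_sum: "A *v sum F S = (\<Sum>s\<in>S. A *v F s)"
  for A :: "'a :: comm_ring_1 ^ 'n ^ 'm"
  by (induction S rule: infinite_finite_induct) (simp_all add: matrix_vector_right_distrib)

lemma scalar_mult_sum: "c *s sum F S = (\<Sum>s\<in>S. c *s F s)"
  for c :: "'a :: comm_ring_1"
  by (induction S rule: infinite_finite_induct) (simp_all add: vector_add_ldistrib)

lemma matrix_vector_mult_scalar: "A *v (c *s v) = c *s (A *v v)"
  for A :: "'a :: comm_ring_1 ^ 'n ^ 'm"
  by (simp add: vec_eq_iff matrix_vector_mult_def mult_ac sum_distrib_left)

lemma fps_const_sum_scalar: "fps_const (sum F S) *s v = (\<Sum>s\<in>S. fps_const (F s) *s v)"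
  for v :: "complex fps ^ 'n"
proof (induction S rule: infinite_finite_induct)
  case (insert a S)
  show ?case
    unfolding sum.insert[OF insert(1,2)] fps_const_add[symmetric] vector_sadd_rdistrib insert.IH ..
qed simp_all

lemma path_action_mult:
  "path_action b (f \<otimes>\<^bsub>path_algebra\<^esub> g) m = path_action b f (path_action b g m)"
proof
  fix j
  show "path_action b (f \<otimes>\<^bsub>path_algebra\<^esub> g) m j = path_action b f (path_action b g m) j"
  proof (rule path_action_eqI)
    fix n :: nat
    define L where "L = 3 * n"
    define w where "w = path_action b f (path_action b g m) j"
    define u where "u = truncated_action b f (path_action b g m) j L"
    define G where "G = (\<lambda>i. truncated_action b g m i L)"
    define v where "v = truncated_action b f G j L"
    define z where "z = truncated_action b (f \<otimes>\<^bsub>path_algebra\<^esub> g) m j (2 * L)"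
    have 1: "vdvd n (w - u)"
      unfolding w_def u_def by (rule path_action_diff) (simp add: L_def)
    have "u - v = (\<Sum>p\<in>Wset j L. fps_const (f p) *s (path_matrix b (snd p) *v
                      (path_action b g m (fst p) - truncated_action b g m (fst p) L)))"
      unfolding u_def v_def G_def truncated_action_Wset[of b f]
      by (simp add: sum_subtractf matrix_vector_mult_diff_distrib vector_ssub_ldistrib)
    then have 2: "vdvd n (u - v)"
      by (auto intro!: vdvd_sum vdvd_simps(4,5) path_action_diff simp: L_def)
    define A where "A = Sigma (Wset j L) (\<lambda>p. Wset (fst p) L)"
    define B where "B = Sigma (Wset j (2 * L)) (\<lambda>p. {..length (snd p)})"
    define t where "t = (\<lambda>(p :: path, q :: path). fps_const (f p * g q) *s
      (path_matrix b (snd p) *v (path_matrix b (snd q) *v m (fst q))))"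
    define \<phi> where "\<phi> = (\<lambda>(p :: path, q :: path). ((fst q, snd q @ snd p), length (snd q)))"
    define \<psi> where "\<psi> = (\<lambda>(p :: path, k). ((end_vertex (fst p) (take k (snd p)), drop k (snd p)),
        (fst p, take k (snd p))))"
    have finA: "finite A" and finB: "finite B"
      unfolding A_def B_def by (auto intro!: finite_SigmaI finite_Wset)
    have "v = (\<Sum>p\<in>Wset j L. \<Sum>q\<in>Wset (fst p) L. t (p, q))"
      unfolding v_def G_def truncated_action_Wset t_def
      unfolding fst_conv snd_conv prod.case matrix_vector_mult_sum scalar_mult_sum
        matrix_vector_mult_scalar vector_smult_assoc fps_const_mult ..
    then have v: "v = sum t A"
      unfolding A_def by (simp add: sum.Sigma finite_Wset)
    have "z = (\<Sum>p\<in>Wset j (2 * L). \<Sum>k\<le>length (snd p). t (\<psi> (p, k)))"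
      unfolding z_def truncated_action_Wset
    proof (intro sum.cong refl)
      fix p :: path
      obtain i as where p: "p = (i, as)" by (metis surj_pair)
      have "path_matrix b as *v m i = path_matrix b (drop k as) *v (path_matrix b (take k as) *v m i)" for k
        unfolding matrix_vector_mul_assoc path_matrix_append[symmetric] append_take_drop_id ..
      then show "fps_const ((f \<otimes>\<^bsub>path_algebra\<^esub> g) p) *s (path_matrix b (snd p) *v m (fst p)) =
          (\<Sum>k\<le>length (snd p). t (\<psi> (p, k)))"
        unfolding p pa_simps fps_const_sum_scalar fst_conv snd_conv t_def \<psi>_def prod.case
        by (intro sum.cong refl) metis
    qed
    then have z: "z = sum (\<lambda>c. t (\<psi> c)) B"
      unfolding B_def by (simp add: sum.Sigma finite_Wset)
    have inv: "\<psi> (\<phi> c) = c" if "c \<in> A" for c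
    proof -
      obtain i as k bs where c: "c = ((i, as), (k, bs))" by (metis surj_pair)
      then have "end_vertex k bs = i" using that by (simp add: A_def Wset_def)
      then show ?thesis by (simp add: c \<phi>_def \<psi>_def)
    qed
    then have "inj_on \<phi> A" by (rule inj_on_inverseI)
    have sub: "\<phi> ` A \<subseteq> B"
      by (auto simp: \<phi>_def A_def B_def Wset_def is_walk_append end_vertex_append)
    have "sum (\<lambda>c. t (\<psi> c)) (\<phi> ` A) = sum (\<lambda>c. t (\<psi> (\<phi> c))) A"
      using \<open>inj_on \<phi> A\<close> by (simp add: sum.reindex)
    also have "\<dots> = sum t A"
      by (intro sum.cong refl) (simp add: inv)
    finally have "z - v = sum (\<lambda>c. t (\<psi> c)) (B - \<phi> ` A)"
      using sum_diff[OF finB sub, of "\<lambda>c. t (\<psi> c)"] unfolding z v by simp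
    moreover have "vdvd n (t (\<psi> c))" if c: "c \<in> B - \<phi> ` A" for c
    proof -
      obtain i as k where cc: "c = ((i, as), k)" by (metis surj_pair)
      have as: "is_walk i as" "end_vertex i as = j" "k \<le> length as"
        using c by (auto simp: cc B_def Wset_def)
      let ?p = "(end_vertex i (take k as), drop k as)" and ?q = "(i, take k as)"
      have wp: "is_walk (end_vertex i (take k as)) (drop k as)" and wq: "is_walk i (take k as)"
        using as(1) is_walk_take_drop by blast+
      have "\<phi> (?p, ?q) = c"
        using as by (simp add: \<phi>_def cc)
      then have "(?p, ?q) \<notin> A" using c by blast
      then have "L \<le> length (drop k as) \<or> L \<le> length (take k as)"
        using wp wq as by (auto simp: A_def Wset_def end_vertex_take_drop)
      then show ?thesis
      proof
        assume "L \<le> length (drop k as)"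
        then have "tdvd n (path_matrix b (drop k as))"
          using tdvd_long[OF wp] by (simp add: L_def)
        then show ?thesis
          by (simp add: t_def \<psi>_def cc vdvd_simps(4) vdvd_tdvd)
      next
        assume "L \<le> length (take k as)"
        then have "tdvd n (path_matrix b (take k as))"
          using tdvd_long[OF wq] unfolding L_def by blast
        then show ?thesis
          by (simp add: t_def \<psi>_def cc vdvd_simps(4,5) vdvd_tdvd)
      qed
    qed
    ultimately have 3: "vdvd n (z - v)"
      by (metis (no_types, lifting) vdvd_sum)
    have "vdvd n ((w - u) + (u - v) - (z - v))"
      by (intro vdvd_simps 1 2 3)
    then have "vdvd n (w - z)" by (simp add: algebra_simps)
    then show "\<exists>l\<ge>3 * n. vdvd n (path_action b f (path_action b g m) j -
      truncated_action b (f \<otimes>\<^bsub>path_algebra\<^esub> g) m j l)"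
      unfolding w_def z_def L_def by (intro exI[of _ "2 * (3 * n)"]) simp
  qed
qed

lemma path_action_one: "path_action b \<one>\<^bsub>path_algebra\<^esub> m = m"
proof
  fix j
  have W: "Wset j (Suc 0) = {(j, [])}" by (auto simp: Wset_def)
  have "path_action b \<one>\<^bsub>path_algebra\<^esub> m j = truncated_action b \<one>\<^bsub>path_algebra\<^esub> m j 1"
    by (rule path_action_finite) (auto simp: pa_simps)
  then show "path_action b \<one>\<^bsub>path_algebra\<^esub> m j = m j"
    by (simp add: truncated_action_Wset W pa_simps)
qed

lemma path_action_arr:
  "path_action b (arr a) m = (\<lambda>j. if j = tgt a then arrow_matrix b a *v m (src a) else 0)"
  unfolding arr_def by (auto simp: path_action_single)

lemma sum_vertex: "sum F (UNIV :: vertex set) =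
  F i + F (i + 1) + F (i + 2) + F (i + 3) + F (i + 4) + F (i + 5) + F (i + 6) + F (i + 7)"
proof -
  have "bij (\<lambda>k. i + k)" by (rule bij_betw_byWitness[where f' = "\<lambda>k. k - i"]) auto
  then have "sum F UNIV = sum (\<lambda>k. F (i + k)) UNIV"
    by (rule sum.reindex_bij_betw[symmetric])
  also have "\<dots> = sum (\<lambda>k. F (i + k)) {0, 1, 2, 3, 4, 5, 6, 7}"
    using vertex_cases by (intro sum.cong) blast+
  finally show ?thesis by (simp add: add_ac)
qed

lemma relations_action:
  assumes b: "sum b UNIV = 0" and r: "r \<in> relations"
  shows "path_action b r m j = 0"
proof -
  interpret ring path_algebra by (rule ring_path_algebra)
  have [simp]: "arr a \<in> carrier path_algebra" for a
    by (auto simp: pa_simps arr_def)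
  have minus: "path_action b (f \<ominus>\<^bsub>path_algebra\<^esub> g) m j = 0"
    if "path_action b f m = path_action b g m" "f \<in> carrier path_algebra" "g \<in> carrier path_algebra" for f g
  proof -
    have "(f \<ominus>\<^bsub>path_algebra\<^esub> g) \<oplus>\<^bsub>path_algebra\<^esub> g = f"
      using that by (simp add: minus_eq a_assoc l_neg)
    then have "(\<lambda>p. (f \<ominus>\<^bsub>path_algebra\<^esub> g) p + g p) = f" by (simp add: pa_simps)
    then have "path_action b (f \<ominus>\<^bsub>path_algebra\<^esub> g) m j + path_action b g m j = path_action b f m j"
      by (metis path_action_add_left)
    then show ?thesis using that by simp
  qed
  from r consider
      i where "r = x_el i \<otimes>\<^bsub>path_algebra\<^esub> y_el i \<ominus>\<^bsub>path_algebra\<^esub> y_el (i+1) \<otimes>\<^bsub>path_algebra\<^esub> x_el (i+1)"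
    | i where "r = x_el (i+4) \<otimes>\<^bsub>path_algebra\<^esub> x_el (i+3) \<otimes>\<^bsub>path_algebra\<^esub> x_el (i+2) \<otimes>\<^bsub>path_algebra\<^esub> x_el (i+1)
        \<ominus>\<^bsub>path_algebra\<^esub> y_el (i-3) \<otimes>\<^bsub>path_algebra\<^esub> y_el (i-2) \<otimes>\<^bsub>path_algebra\<^esub> y_el (i-1) \<otimes>\<^bsub>path_algebra\<^esub> y_el i"
    unfolding relations_def by blast
  then show ?thesis
  proof cases
    case 1
    have "arrow_matrix b (Xarr i) ** arrow_matrix b (Yarr i) = mat22 fps_X 0 0 fps_X"
      by (simp add: mat22_mult algebra_simps)
    moreover have "arrow_matrix b (Yarr (i+1)) ** arrow_matrix b (Xarr (i+1)) = mat22 fps_X 0 0 fps_X"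
      by (simp add: mat22_mult algebra_simps)
    ultimately show ?thesis
      unfolding 1
      by (intro minus m_closed)
        (auto simp: path_action_mult path_action_arr matrix_vector_mul_assoc simp del: arrow_matrix.simps)
  next
    case 2
    have v: "i - 1 = i + 7" "i - 2 = i + 6" "i - 3 = i + 5" "i - 4 = i + 4"
      by (simp_all add: algebra_simps)
    have p: "2 dvd i + 1 \<longleftrightarrow> \<not> 2 dvd i" "2 dvd i + 2 \<longleftrightarrow> 2 dvd i" "2 dvd i + 3 \<longleftrightarrow> \<not> 2 dvd i"
      "2 dvd i + 4 \<longleftrightarrow> 2 dvd i" "2 dvd i + 5 \<longleftrightarrow> \<not> 2 dvd i" "2 dvd i + 6 \<longleftrightarrow> 2 dvd i"
      "2 dvd i + 7 \<longleftrightarrow> \<not> 2 dvd i"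
      using two_dvd_vertex(1)[of i] two_dvd_vertex(1)[of "i + 1"] two_dvd_vertex(1)[of "i + 2"] two_dvd_vertex(1)[of "i + 3"]
        two_dvd_vertex(1)[of "i + 4"] two_dvd_vertex(1)[of "i + 5"] two_dvd_vertex(1)[of "i + 6"]
      by (simp_all add: add.assoc)
    define s where "s = b (i+1) + b (i+2) + b (i+3) + b (i+4)"
    have "(b i + b (i+7) + b (i+6) + b (i+5)) + s = 0"
      using b unfolding s_def sum_vertex[of b i] by (simp add: add_ac)
    then have s: "- (b i + b (i+7) + b (i+6) + b (i+5)) = s"
      by (rule group_add_class.minus_unique)
    have b4: "b (i+4) = s - b (i+1) - b (i+2) - b (i+3)" by (simp add: s_def)
    have b5: "b (i+5) = - s - b i - b (i+7) - b (i+6)" by (simp flip: s)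
    have x: "arrow_matrix b (Xarr (i+4)) ** (arrow_matrix b (Xarr (i+3)) **
        (arrow_matrix b (Xarr (i+2)) ** arrow_matrix b (Xarr (i+1)))) =
        mat22 (fps_X^2) ((if 2 dvd i then fps_X else fps_X^2) * s) 0 (fps_X^2)"
      by (cases "2 dvd i") (simp_all add: p p[unfolded add.commute[of i]] mat22_mult b4 algebra_simps power2_eq_square)
    have y: "arrow_matrix b (Yarr (i+5)) ** (arrow_matrix b (Yarr (i+6)) **
        (arrow_matrix b (Yarr (i+7)) ** arrow_matrix b (Yarr i))) =
        mat22 (fps_X^2) ((if 2 dvd i then fps_X else fps_X^2) * s) 0 (fps_X^2)"
      by (cases "2 dvd i") (simp_all add: p p[unfolded add.commute[of i]] mat22_mult b5 algebra_simps power2_eq_square)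
    have idx: "i + 4 - 1 = i + 3" "i + 3 - 1 = i + 2" "i + 2 - 1 = i + 1" "i + 1 - 1 = i"
       "i + 7 - 1 = i + 6" "i + 6 - 1 = i + 5" "i + 5 - 1 = i + 4"
      by (simp_all add: algebra_simps)
    have "path_action b (x_el (i+4) \<otimes>\<^bsub>path_algebra\<^esub> x_el (i+3) \<otimes>\<^bsub>path_algebra\<^esub> x_el (i+2) \<otimes>\<^bsub>path_algebra\<^esub> x_el (i+1)) m
       = (\<lambda>j. if j = i + 4 then mat22 (fps_X^2) ((if 2 dvd i then fps_X else fps_X^2) * s) 0 (fps_X^2) *v m i else 0)"
      unfolding x[symmetric] path_action_mult path_action_arr src.simps tgt.simps idx
      by (auto simp: matrix_vector_mul_assoc matrix_mul_assoc simp del: arrow_matrix.simps)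
    moreover have "path_action b (y_el (i-3) \<otimes>\<^bsub>path_algebra\<^esub> y_el (i-2) \<otimes>\<^bsub>path_algebra\<^esub> y_el (i-1) \<otimes>\<^bsub>path_algebra\<^esub> y_el i) m
       = (\<lambda>j. if j = i + 4 then mat22 (fps_X^2) ((if 2 dvd i then fps_X else fps_X^2) * s) 0 (fps_X^2) *v m i else 0)"
      unfolding y[symmetric] path_action_mult path_action_arr src.simps tgt.simps v idx
      by (auto simp: matrix_vector_mul_assoc matrix_mul_assoc simp del: arrow_matrix.simps)
    ultimately show ?thesis
      unfolding 2 by (intro minus m_closed) simp_all
  qed
qed

lemma closed_ideal_action:
  assumes b: "sum b UNIV = 0" and f: "f \<in> adic_closure (Idl\<^bsub>path_algebra\<^esub> relations)"
  shows "path_action b f m j = 0"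
proof -
  interpret ring path_algebra by (rule ring_path_algebra)
  define Ann where "Ann = {f \<in> carrier path_algebra. \<forall>m j. path_action b f m j = 0}"
  have zero: "path_action b \<zero>\<^bsub>path_algebra\<^esub> m j = 0" for m j
    using path_action_finite[of 0 "\<zero>\<^bsub>path_algebra\<^esub>" b m j]
    by (simp add: pa_simps truncated_action_Wset)
  have zero': "path_action b g (\<lambda>j. 0) j = 0" for g j
    using path_action_add_right[of b g "\<lambda>j. 0" "\<lambda>j. 0" j] by simp
  have Annz: "path_action b f m = (\<lambda>j. 0)" if "f \<in> Ann" for f m
    using that by (auto simp: Ann_def)
  have "ideal Ann path_algebra"
  proof (rule idealI[OF ring_path_algebra])
    show "subgroup Ann (add_monoid path_algebra)"
    proof (rule add.subgroupI)
      show "Ann \<subseteq> carrier path_algebra" by (auto simp: Ann_def)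
      show "Ann \<noteq> {}" using zero zero_closed by (auto simp: Ann_def)
    next
      fix f assume f: "f \<in> Ann"
      then have fc: "f \<in> carrier path_algebra" by (simp add: Ann_def)
      have "(\<lambda>p. (\<ominus>\<^bsub>path_algebra\<^esub> f) p + f p) = \<zero>\<^bsub>path_algebra\<^esub>"
        using l_neg[OF fc] by (simp add: pa_simps)
      then have "path_action b (\<ominus>\<^bsub>path_algebra\<^esub> f) m j = 0" for m j
        using path_action_add_left[of b "\<ominus>\<^bsub>path_algebra\<^esub> f" f m j] zero[of m j] Annz[OF f, of m] by simp
      then show "\<ominus>\<^bsub>path_algebra\<^esub> f \<in> Ann" using fc by (auto simp: Ann_def)
    next
      fix f g assume "f \<in> Ann" "g \<in> Ann"
      then show "f \<oplus>\<^bsub>path_algebra\<^esub> g \<in> Ann"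
        using a_closed[of f g] by (auto simp: Ann_def pa_simps(5) path_action_add_left)
    qed
  next
    fix f g assume f: "f \<in> Ann" and g: "g \<in> carrier path_algebra"
    show "g \<otimes>\<^bsub>path_algebra\<^esub> f \<in> Ann"
      using f g m_closed[of g f] by (auto simp: Ann_def path_action_mult Annz[OF f] zero')
    show "f \<otimes>\<^bsub>path_algebra\<^esub> g \<in> Ann"
      using f g m_closed[of f g] by (auto simp: Ann_def path_action_mult)
  qed
  moreover have "relations \<subseteq> Ann"
    using relations_subset relations_action[OF b] by (auto simp: Ann_def)
  ultimately have sub: "Idl\<^bsub>path_algebra\<^esub> relations \<subseteq> Ann"
    by (rule genideal_minimal)
  show ?thesis
  proof (rule path_action_eqI)
    fix n
    obtain g where g: "g \<in> Ann" "\<And>i as. length as < 3 * n \<Longrightarrow> f (i, as) = g (i, as)"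
      using f sub unfolding adic_closure_def by blast
    have "truncated_action b f m j (3 * n) = truncated_action b g m j (3 * n)"
      unfolding truncated_action_Wset by (intro sum.cong) (auto simp: Wset_def g(2))
    then show "\<exists>l\<ge>3 * n. vdvd n (0 - truncated_action b f m j l)"
      using path_action_diff[of n "3 * n" b g m j] Annz[OF g(1), of m]
      by (intro exI[of _ "3 * n"]) simp
  qed
qed

lemma MM_smult_coset:
  assumes b: "sum b UNIV = 0" and f: "f \<in> carrier path_algebra"
  shows "(adic_closure (Idl\<^bsub>path_algebra\<^esub> relations) +>\<^bsub>path_algebra\<^esub> f) \<odot>\<^bsub>MM b\<^esub> m = path_action b f m"
proof -
  let ?J = "adic_closure (Idl\<^bsub>path_algebra\<^esub> relations)"
  interpret ring path_algebra by (rule ring_path_algebra)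
  interpret J: ideal ?J path_algebra
    by (intro ideal_adic_closure genideal_ideal relations_subset)
  define g where "g = (SOME g. g \<in> ?J +>\<^bsub>path_algebra\<^esub> f)"
  have "f \<in> ?J +>\<^bsub>path_algebra\<^esub> f" by (rule J.a_rcos_self[OF f])
  then have "g \<in> ?J +>\<^bsub>path_algebra\<^esub> f" unfolding g_def by (rule someI[where P = "\<lambda>g. g \<in> ?J +>\<^bsub>path_algebra\<^esub> f"])
  then obtain h where h: "h \<in> ?J" "g = h \<oplus>\<^bsub>path_algebra\<^esub> f"
    unfolding a_r_coset_def' by blast
  have "path_action b g m = path_action b f m"
    using closed_ideal_action[OF b h(1)] unfolding h(2) pa_simps
    by (auto simp: path_action_add_left)
  then show ?thesis by (simp add: MM_def g_def)
qed

theorem left_module_MM: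
  assumes b: "sum b UNIV = 0"
  shows "left_module B48 (MM b)"
proof -
  let ?J = "adic_closure (Idl\<^bsub>path_algebra\<^esub> relations)"
  interpret ring path_algebra by (rule ring_path_algebra)
  interpret J: ideal ?J path_algebra
    by (intro ideal_adic_closure genideal_ideal relations_subset)
  have coset: "\<exists>f\<in>carrier path_algebra. C = ?J +>\<^bsub>path_algebra\<^esub> f" if "C \<in> carrier B48" for C
    using that unfolding B48_def FactRing_def A_RCOSETS_def' by auto
  have add: "(?J +>\<^bsub>path_algebra\<^esub> f) \<oplus>\<^bsub>B48\<^esub> (?J +>\<^bsub>path_algebra\<^esub> g) = ?J +>\<^bsub>path_algebra\<^esub> (f \<oplus>\<^bsub>path_algebra\<^esub> g)"
    if "f \<in> carrier path_algebra" "g \<in> carrier path_algebra" for f g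
    using that J.a_rcos_sum by (simp add: B48_def FactRing_def)
  have mult: "(?J +>\<^bsub>path_algebra\<^esub> f) \<otimes>\<^bsub>B48\<^esub> (?J +>\<^bsub>path_algebra\<^esub> g) = ?J +>\<^bsub>path_algebra\<^esub> (f \<otimes>\<^bsub>path_algebra\<^esub> g)"
    if "f \<in> carrier path_algebra" "g \<in> carrier path_algebra" for f g
    using that J.rcoset_mult_add by (simp add: B48_def FactRing_def)
  have one: "\<one>\<^bsub>B48\<^esub> = ?J +>\<^bsub>path_algebra\<^esub> \<one>\<^bsub>path_algebra\<^esub>"
    by (simp add: B48_def FactRing_def)
  note smult = MM_smult_coset[OF b]
  have MM: "carrier (MM b) = UNIV" "m \<oplus>\<^bsub>MM b\<^esub> m' = (\<lambda>j. m j + m' j)" "\<zero>\<^bsub>MM b\<^esub> = (\<lambda>j. 0)" for m m'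
    by (simp_all add: MM_def)
  have "abelian_group (MM b)"
  proof (rule abelian_groupI)
    fix m :: "vertex \<Rightarrow> complex fps ^ 2"
    show "\<exists>m'\<in>carrier (MM b). m' \<oplus>\<^bsub>MM b\<^esub> m = \<zero>\<^bsub>MM b\<^esub>"
      by (intro bexI[of _ "\<lambda>j. - m j"]) (simp_all add: MM)
  qed (auto simp: MM add_ac)
  then show ?thesis
  proof (intro left_module.intro ring_B48 left_module_axioms.intro)
    fix C D m m' assume C: "C \<in> carrier B48"
    obtain f where f: "f \<in> carrier path_algebra" "C = ?J +>\<^bsub>path_algebra\<^esub> f" using coset[OF C] by blast
    show "C \<odot>\<^bsub>MM b\<^esub> m \<in> carrier (MM b)" by (simp add: MM)
    show "C \<odot>\<^bsub>MM b\<^esub> (m \<oplus>\<^bsub>MM b\<^esub> m') = C \<odot>\<^bsub>MM b\<^esub> m \<oplus>\<^bsub>MM b\<^esub> C \<odot>\<^bsub>MM b\<^esub> m'"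
      unfolding f(2) smult[OF f(1)] MM by (auto simp: path_action_add_right)
    assume D: "D \<in> carrier B48"
    obtain g where g: "g \<in> carrier path_algebra" "D = ?J +>\<^bsub>path_algebra\<^esub> g" using coset[OF D] by blast
    show "(C \<oplus>\<^bsub>B48\<^esub> D) \<odot>\<^bsub>MM b\<^esub> m = C \<odot>\<^bsub>MM b\<^esub> m \<oplus>\<^bsub>MM b\<^esub> D \<odot>\<^bsub>MM b\<^esub> m"
      unfolding f(2) g(2) add[OF f(1) g(1)] smult[OF f(1)] smult[OF g(1)] smult[OF a_closed[OF f(1) g(1)]] MM
      by (auto simp: pa_simps path_action_add_left)
    show "(C \<otimes>\<^bsub>B48\<^esub> D) \<odot>\<^bsub>MM b\<^esub> m = C \<odot>\<^bsub>MM b\<^esub> (D \<odot>\<^bsub>MM b\<^esub> m)"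
      unfolding f(2) g(2) mult[OF f(1) g(1)] smult[OF f(1)] smult[OF g(1)] smult[OF m_closed[OF f(1) g(1)]]
      by (rule path_action_mult)
  next
    fix m show "\<one>\<^bsub>B48\<^esub> \<odot>\<^bsub>MM b\<^esub> m = m"
      unfolding one smult[OF one_closed] by (rule path_action_one)
  qed
qed

lemma M_beta_coeffs_exist:
  "M_beta_coeffs \<beta> (\<lambda>i. if i = 1 then 1 else if i = 3 then fps_const \<beta> else
     if i = 5 then - 1 else if i = 7 then - fps_const \<beta> else 0)"
  by (simp add: M_beta_coeffs_def)

lemma M_beta_coeffs_sum: "M_beta_coeffs \<beta> b \<Longrightarrow> sum b UNIV = 0"
  unfolding sum_vertex[of b 1] M_beta_coeffs_def by (simp add: add.assoc)

end

theory Submission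
  imports Defs
begin

text \<open>Let \<open>\<sigma> i = c 1 + \<dots> + c i\<close>. Over the field of Laurent series the maps \<open>x\<close> identify the
  lattices of \<open>\<M>(c)\<close> at the even vertices with lattices in one plane which all lie between \<open>t L\<close>
  and \<open>L\<close> for a common lattice \<open>L\<close>, so they are four lines in \<open>L / t L\<close>, with slopes given by
  the constant terms of \<open>\<sigma> 0, \<sigma> 2, \<sigma> 4, \<sigma> 6\<close>; the lattices at the odd vertices are copies of
  \<open>L\<close>. The hypotheses say that these four points of the projective line are distinct. For
  \<open>\<M>\<^sub>\<beta>\<close> the points are \<open>0, 1, 1 + \<beta>, \<beta>\<close>, with cross ratio \<open>1 / \<beta>\<^sup>2\<close>, so by choosing \<open>\<beta>\<close> as a
  square root some Moebius transformation matches the two quadruples, and it lifts to an isomorphism.\<close>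

lemma path_matrix_intertwine:
  assumes P: "\<And>a. P (tgt a) ** arrow_matrix c a = arrow_matrix d a ** P (src a)"
    and "is_walk i as"
  shows "P (end_vertex i as) ** path_matrix c as = path_matrix d as ** P i"
  using assms(2)
proof (induction as arbitrary: i)
  case (Cons a as)
  then have "P (end_vertex i (a # as)) ** path_matrix c (a # as) =
      path_matrix d as ** (P (tgt a) ** arrow_matrix c a)"
    by (simp add: matrix_mul_assoc)
  also have "\<dots> = path_matrix d (a # as) ** P i"
    using Cons.prems by (simp add: P matrix_mul_assoc)
  finally show ?case .
qed simp

text \<open>Paths of length at least \<open>3 * n\<close> act by matrices divisible by the n-th
  power of t, so compatibility with single arrows passes from the finite truncations to the
  limit.\<close>

lemma path_action_intertwine:
  assumes P: "\<And>a. P (tgt a) ** arrow_matrix c a = arrow_matrix d a ** P (src a)"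
  shows "path_action d f (\<lambda>i. P i *v m i) j = P j *v path_action c f m j"
proof (rule path_action_eqI)
  fix n
  have "truncated_action d f (\<lambda>i. P i *v m i) j (3 * n) = P j *v truncated_action c f m j (3 * n)"
    unfolding truncated_action_Wset matrix_vector_mult_sum matrix_vector_mult_scalar
      matrix_vector_mul_assoc
    by (intro sum.cong refl)
      (auto simp: Wset_def path_matrix_intertwine[where P = P, OF P, symmetric])
  then have "P j *v path_action c f m j - truncated_action d f (\<lambda>i. P i *v m i) j (3 * n) =
      P j *v (path_action c f m j - truncated_action c f m j (3 * n))"
    by (simp add: matrix_vector_mult_diff_distrib)
  then show "\<exists>l\<ge>3 * n. vdvd n (P j *v path_action c f m j -
      truncated_action d f (\<lambda>i. P i *v m i) j l)"
    by (intro exI[of _ "3 * n"]) (simp add: vdvd_simps(5) path_action_diff)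
qed

lemma module_isomorphic_MM:
  assumes P: "\<And>a. P (tgt a) ** arrow_matrix c a = arrow_matrix d a ** P (src a)"
    and Q: "\<And>j. P j ** Q j = mat 1" "\<And>j. Q j ** P j = mat 1"
  shows "module_isomorphic R (MM c) (MM d)"
  unfolding module_isomorphic_def
proof (intro exI[of _ "\<lambda>m j. P j *v m j"] conjI ballI)
  show "bij_betw (\<lambda>m j. P j *v m j) (carrier (MM c)) (carrier (MM d))"
    by (rule bij_betw_byWitness[where f' = "\<lambda>m j. Q j *v m j"])
      (simp_all add: MM_def matrix_vector_mul_assoc Q)
qed (simp_all add: MM_def fun_eq_iff matrix_vector_right_distrib path_action_intertwine[where P = P, OF P])

text \<open>One turn around the cycle adds the total of \<open>c\<close>, so the recursion closes up
  at vertex 0 because this total vanishes.\<close>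

lemma partial_sums_exist:
  fixes c :: "vertex \<Rightarrow> 'a :: ab_group_add"
  assumes "sum c UNIV = 0"
  shows "\<exists>\<sigma>. \<sigma> 0 = 0 \<and> (\<forall>i. \<sigma> i = \<sigma> (i - 1) + c i)"
proof -
  define \<sigma> where "\<sigma> i =
    (if i = 1 then c 1 else if i = 2 then c 1 + c 2 else if i = 3 then c 1 + c 2 + c 3
     else if i = 4 then c 1 + c 2 + c 3 + c 4 else if i = 5 then c 1 + c 2 + c 3 + c 4 + c 5
     else if i = 6 then c 1 + c 2 + c 3 + c 4 + c 5 + c 6
     else if i = 7 then c 1 + c 2 + c 3 + c 4 + c 5 + c 6 + c 7 else 0)" for i :: vertex
  have "c 1 + c 2 + c 3 + c 4 + c 5 + c 6 + c 7 + c 0 = 0"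
    using assms unfolding sum_vertex[of c 0] by (simp add: add_ac)
  then have "\<sigma> i = \<sigma> (i - 1) + c i" for i
    using vertex_cases[of i] by (elim disjE) (simp_all add: \<sigma>_def)
  then show ?thesis by (intro exI[of _ \<sigma>]) (auto simp: \<sigma>_def)
qed

text \<open>The matrix \<open>P\<close> below is the Moebius transformation \<open>z \<mapsto> p z / (s - r z)\<close>, written in the bases
  of the lattices at the various vertices.\<close>

lemma module_isomorphic_MM_moebius:
  fixes c d \<sigma> \<tau> :: "vertex \<Rightarrow> complex fps" and p r s :: complex
  assumes \<sigma>: "\<And>i. \<sigma> i = \<sigma> (i - 1) + c i" and \<tau>: "\<And>i. \<tau> i = \<tau> (i - 1) + d i"
    and ps: "p \<noteq> 0" "s \<noteq> 0"
    and moebius: "\<And>i. 2 dvd i \<Longrightarrow> fps_nth (\<tau> i) 0 * (s - r * fps_nth (\<sigma> i) 0) = p * fps_nth (\<sigma> i) 0"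
  shows "module_isomorphic R (MM c) (MM d)"
proof -
  define p' r' s' where "p' = fps_const p" and "r' = fps_const r" and "s' = fps_const s"
  define u where "u = fps_const (1 / (p * s))"
  have u: "u * (p' * s') = 1"
    using ps by (simp add: u_def p'_def s'_def fps_const_mult)
  \<comment> \<open>The product of ((1, \<tau> i), (0, 1)), ((p, 0), (r, s)) and ((1, -\<sigma> i),
    (0, 1)) has upper right entry \<open>F i\<close>; its other entries are \<open>A i\<close>,
    \<open>r'\<close> and \<open>D i\<close> below. At even vertices it is conjugated by diag(1, t),
    which divides \<open>F i\<close> by t.\<close>
  define F where "F i = \<tau> i * s' - \<sigma> i * p' - \<sigma> i * \<tau> i * r'" for i
  have "\<exists>e. 2 dvd i \<longrightarrow> F i = fps_X * e" for i
  proof (cases "2 dvd i")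
    case True
    then have "fps_X ^ 1 dvd F i"
      using moebius[OF True] unfolding fps_X_power_dvd
      by (simp add: F_def p'_def r'_def s'_def algebra_simps)
    then show ?thesis by (auto elim: dvdE)
  qed simp
  then obtain E where E: "\<And>i. 2 dvd i \<Longrightarrow> F i = fps_X * E i" by metis
  define A where "A i = p' + \<tau> i * r'" for i
  define D where "D i = s' - r' * \<sigma> i" for i
  define P where "P i = (if 2 dvd i then mat22 (A i) (E i) (fps_X * r') (D i)
    else mat22 (A i) (F i) r' (D i))" for i
  \<comment> \<open>The adjugate of \<open>P i\<close> divided by its determinant, which is p s at
    every vertex.\<close>
  define Q where "Q i = (if 2 dvd i then mat22 (u * D i) (- u * E i) (- u * fps_X * r') (u * A i)
    else mat22 (u * D i) (- u * F i) (- u * r') (u * A i))" for i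
  have det: "A i * D i - r' * F i = p' * s'" for i
    by (simp add: A_def D_def F_def algebra_simps)
  have det': "u * A i * D i - u * r' * F i = 1" for i
    using det[of i] u by (metis (no_types, lifting) mult.assoc right_diff_distrib)
  have one: "mat 1 = mat22 1 0 0 (1 :: complex fps)"
    by (simp add: mat_def mat22_def vec_eq_iff forall_2)
  have "P (tgt a) ** arrow_matrix c a = arrow_matrix d a ** P (src a)" for a
  proof -
    have arrow: "P i ** arrow_matrix c (Xarr i) = arrow_matrix d (Xarr i) ** P (i - 1) \<and>
        P (i - 1) ** arrow_matrix c (Yarr i) = arrow_matrix d (Yarr i) ** P i" for i
    proof -
      have c: "c i = \<sigma> i - \<sigma> (i - 1)" and d: "d i = \<tau> i - \<tau> (i - 1)"
        using \<sigma>[of i] \<tau>[of i] by simp_all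
      show ?thesis
      proof (cases "2 dvd i")
        case True
        then show ?thesis
          using E[OF True]
          by (simp add: P_def two_dvd_vertex mat22_mult)
            (simp add: c d A_def D_def F_def algebra_simps)
      next
        case False
        then have "2 dvd i - 1" by (simp add: two_dvd_vertex)
        then show ?thesis
          using False E[of "i - 1"]
          by (simp add: P_def two_dvd_vertex mat22_mult)
            (simp add: c d A_def D_def F_def algebra_simps)
      qed
    qed
    then show ?thesis by (cases a) simp_all
  qed
  moreover have "P j ** Q j = mat 1 \<and> Q j ** P j = mat 1" for j
    using det'[of j] E[of j] unfolding P_def Q_def one
    by (cases "2 dvd j") (simp_all add: mat22_mult algebra_simps)
  ultimately show ?thesis
    by (intro module_isomorphic_MM[where P = P and Q = Q]) blast+
qed

text \<open>In terms of \<open>w = 1 / z\<close> the condition is that an affine map sends \<open>w1, w2, w3\<close> to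
  \<open>1, 1 / (1 + \<beta>), 1 / \<beta>\<close>, that is, \<open>(w1 - w2) / (w3 - w2) = \<beta>\<^sup>2\<close>.\<close>

lemma moebius_to_parallelogram:
  fixes z1 z2 z3 :: complex
  assumes "z1 \<noteq> 0" "z2 \<noteq> 0" "z3 \<noteq> 0" "z1 \<noteq> z2" "z1 \<noteq> z3" "z2 \<noteq> z3"
  obtains \<beta> r s where "\<beta> \<notin> {0, 1, -1}" "s \<noteq> 0" "s - r * z1 = z1"
    "(1 + \<beta>) * (s - r * z2) = z2" "\<beta> * (s - r * z3) = z3"
proof -
  define w1 w2 w3 where "w1 = 1 / z1" and "w2 = 1 / z2" and "w3 = 1 / z3"
  have w: "w1 \<noteq> w2" "w1 \<noteq> w3" "w2 \<noteq> w3"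
    using assms by (auto simp: w1_def w2_def w3_def)
  \<comment> \<open>As the three w are distinct, the quotient is neither 0 nor 1, which excludes 0,
    1 and -1 as its root.\<close>
  define \<beta> where "\<beta> = csqrt ((w1 - w2) / (w3 - w2))"
  have sq: "\<beta>\<^sup>2 * (w3 - w2) = w1 - w2"
    using w by (simp add: \<beta>_def)
  have \<beta>: "\<beta> \<noteq> 0" "\<beta> \<noteq> 1" "\<beta> \<noteq> - 1"
    using sq w by auto
  then have \<beta>': "1 + \<beta> \<noteq> 0" by (metis add_eq_0_iff)
  \<comment> \<open>The affine map w \<mapsto> s w - r is fixed by sending w1 to 1 and w3 to 1 /
    \<beta>; the choice of \<beta> then forces the value at w2.\<close>
  define s where "s = (1 - 1 / \<beta>) / (w1 - w3)"
  define r where "r = s * w1 - 1"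
  have s: "\<beta> * s * (w1 - w3) = \<beta> - 1"
    using \<beta> w by (simp add: s_def field_simps)
  have 3: "\<beta> * (s * w3 - r) = 1"
    using s by (simp add: r_def algebra_simps)
  \<comment> \<open>The factor \<beta> - 1 lets \<open>s\<close> and \<open>sq\<close> be used
    without division; it cancels because \<beta> is not 1.\<close>
  have "(\<beta> - 1) * ((1 + \<beta>) * (s * w2 - r) - 1) = 0"
  proof -
    have "(\<beta> - 1) * (1 + \<beta>) * (w1 - w2) = \<beta>\<^sup>2 * (w1 - w3)"
      using sq by (simp add: algebra_simps power2_eq_square)
    from arg_cong[OF this, of "(*) s"]
    have "(\<beta> - 1) * (1 + \<beta>) * (s * (w1 - w2)) = \<beta> * (\<beta> * s * (w1 - w3))"
      by (simp only: power2_eq_square mult_ac)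
    then show ?thesis
      unfolding s by (simp add: r_def algebra_simps)
  qed
  then have 2: "(1 + \<beta>) * (s * w2 - r) = 1" using \<beta> by simp
  show ?thesis
  proof
    show "\<beta> \<notin> {0, 1, -1}" using \<beta> by simp
    show "s \<noteq> 0" using s \<beta> by auto
    show "s - r * z1 = z1"
      using assms by (simp add: r_def w1_def field_simps)
    have "s - r * z2 = z2 * (s * w2 - r)" "s - r * z3 = z3 * (s * w3 - r)"
      using assms by (simp_all add: w2_def w3_def field_simps)
    then show "(1 + \<beta>) * (s - r * z2) = z2" "\<beta> * (s - r * z3) = z3"
      using 2 3 by (metis mult.left_commute mult.right_neutral)+
  qed
qed

theorem proposition5p17:
  fixes c :: "8 \<Rightarrow> complex fps"
  assumes "(\<Sum>i\<in>UNIV. c i) = 0"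
    and "indecomposable_module B48 (MM c)"
    and "\<And>i. \<not> 2 dvd i \<Longrightarrow> \<not> fps_X dvd c i + c (i + 1)"
    and "\<And>i. \<not> 2 dvd i \<Longrightarrow> \<not> fps_X dvd c i + c (i + 1) + c (i + 2) + c (i + 3)"
  shows "\<exists>\<beta>. \<beta> \<notin> {0, 1, -1} \<and> module_isomorphic B48 (MM c) (M_beta \<beta>)"
proof -
  obtain \<sigma> where \<sigma>0: "\<sigma> 0 = 0" and \<sigma>: "\<And>i. \<sigma> i = \<sigma> (i - 1) + c i"
    using partial_sums_exist[OF assms(1)] by blast
  define z where "z i = fps_nth (\<sigma> i) 0" for i
  have dvd: "fps_X dvd f \<longleftrightarrow> fps_nth f 0 = 0" for f :: "complex fps"
    using fps_X_power_dvd[of 1 f] by simp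
  have z: "fps_nth (c i) 0 = z i - z (i - 1)" for i
    unfolding z_def by (subst \<sigma>) simp
  have "(8 :: vertex) = 0" by simp
  then have z0: "z 0 = 0" "z 8 = 0" by (simp_all only: z_def \<sigma>0 fps_zero_nth)
  \<comment> \<open>The two-term sums separate cyclically adjacent points among \<open>z 0\<close>,
    \<open>z 2\<close>, \<open>z 4\<close>, \<open>z 6\<close>; the four-term sums separate the two
    opposite pairs.\<close>
  have distinct: "z 2 \<noteq> 0" "z 4 \<noteq> 0" "z 6 \<noteq> 0" "z 2 \<noteq> z 4" "z 2 \<noteq> z 6" "z 4 \<noteq> z 6"
    using assms(3)[OF odd_vertex(1)] assms(3)[OF odd_vertex(2)] assms(3)[OF odd_vertex(3)]
      assms(3)[OF odd_vertex(4)] assms(4)[OF odd_vertex(1)] assms(4)[OF odd_vertex(2)]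
    by (simp_all add: dvd z z0)
  obtain \<beta> r s where \<beta>: "\<beta> \<notin> {0, 1, -1}" and s: "s \<noteq> 0"
    and moebius: "s - r * z 2 = z 2" "(1 + \<beta>) * (s - r * z 4) = z 4" "\<beta> * (s - r * z 6) = z 6"
    using moebius_to_parallelogram[OF distinct] .
  define d where "d = (SOME b. M_beta_coeffs \<beta> b)"
  have d: "M_beta_coeffs \<beta> d"
    unfolding d_def by (rule someI[of "M_beta_coeffs \<beta>", OF M_beta_coeffs_exist])
  obtain \<tau> where \<tau>0: "\<tau> 0 = 0" and \<tau>: "\<And>i. \<tau> i = \<tau> (i - 1) + d i"
    using partial_sums_exist[OF M_beta_coeffs_sum[OF d]] by blast
  have \<tau>2: "\<tau> 2 = d 1 + d 2"
    using \<tau>[of 2] \<tau>[of 1] by (simp add: \<tau>0)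
  have \<tau>4: "\<tau> 4 = \<tau> 2 + (d 3 + d 4)"
    using \<tau>[of 4] \<tau>[of 3] by (simp add: add.assoc)
  have \<tau>6: "\<tau> 6 = \<tau> 4 + (d 5 + d 6)"
    using \<tau>[of 6] \<tau>[of 5] by (simp add: add.assoc)
  have "\<tau> 2 = 1" "\<tau> 4 = 1 + fps_const \<beta>" "\<tau> 6 = fps_const \<beta>"
    unfolding \<tau>6 \<tau>4 \<tau>2 using d by (simp_all add: M_beta_coeffs_def)
  \<comment> \<open>At vertex 0 both points are 0; at 2, 4 and 6 this is \<open>moebius\<close>,
    with p scaled to 1.\<close>
  then have "fps_nth (\<tau> i) 0 * (s - r * fps_nth (\<sigma> i) 0) = 1 * fps_nth (\<sigma> i) 0" if "2 dvd i" for i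
    using vertex_cases[of i] that odd_vertex moebius
    by (elim disjE) (simp_all add: \<tau>0 \<sigma>0 z_def)
  then have "module_isomorphic B48 (MM c) (MM d)"
    by (intro module_isomorphic_MM_moebius[where \<sigma> = \<sigma> and \<tau> = \<tau>, OF \<sigma> \<tau> one_neq_zero s])
  then show ?thesis
    using \<beta> unfolding M_beta_def d_def by blast
qed

end
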